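(* Let $M_{par}$ be a partial model, $p,q\in\mathcal{PV}$ and $\Gamma\subseteq\mathcal{A}$. Consider $SApp_{M_{par}}(\phi,\mathcal{V}_{M_1},\mathcal{V}_{M_2})$ as a function of the two vectors of variables $\mathcal{V}_{M_1}=(TB^1_1,\dots,TB^1_n,VB^1)$ and $\mathcal{V}_{M_2}=(TB^2_1,\dots,TB^2_n,VB^2)$ (ranging over encodings of models compatible with $M_{par}$). Then: (i) for $\phi\in\{p,\neg p,p\wedge q\}$, it is positive monotonic w.r.t. $TB^1_i$ for $i\in\mathcal{A}$ and $VB^1$, and negative monotonic w.r.t. $TB^2_i$ for $i\in\mathcal{A}$ and $VB^2$; (ii) for $\phi\in\{\langle\langle\Gamma\rangle\rangle\mathrm{X}p,\langle\langle\Gamma\rangle\rangle\mathrm{G}p,\langle\langle\Gamma\rangle\rangle p\mathrm{U}q\}$, it is positive monotonic w.r.t. $TB^1_i$ for $i\in\Gamma$ and $VB^1$, and negative monotonic w.r.t. $TB^2_i$ for $i\in\Gamma$ and $VB^2$.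
   Context: Fix agents $\mathcal{A}=\{1,\dots,n\}$, a finite set $\mathcal{PV}$ of propositional variables, and for each agent $i$ local states $L_i=\{l_i^1,\dots,l_i^{n_i}\}$ and actions $Act_i=\{a_i^1,\dots,a_i^{n_i}\}$ with local transitions $T_i(l_i^k,a_i^j)=l_i^j$, defined iff $a_i^j$ is allowed by agent $i$'s protocol at $l_i^k$. Given protocols $P_i:L_i\to 2^{Act_i}$ and valuation $V:St\to 2^{\mathcal{PV}}$ on $St=L_1\times\dots\times L_n$, the model $M$ has global transitions $T(g,a)=g'$ iff $T_i(g^i,a^i)=g'^i$ for all $i$. Encoding: $P_i$ is a Boolean $n_i\times n_i$ table (entry $(l,a)$ is $1$ iff $a\in P_i(l)$) flattened into $tb_i$ (variables $TB_i$); $V$ is a bit vector $vb$ of length $|St|\cdot|\mathcal{PV}|$ (variables $VB$); $v_M=(tb_1,\dots,tb_n,vb)$. Paths, strategies, outcomes: a path from $g$ is $g_0a_0g_1\dots$ with $g_0=g$, $T(g_k,a_k)=g_{k+1}$, $\pi[k]=g_k$; a strategy of $i$ is $\sigma_i:St\to Act_i$ with $\sigma_i(g)\in P_i(g^i)$; $out_M(g,\sigma_\Gamma)$ is the set of paths from $g$ where agents $j\in\Gamma$ always act by $\sigma_j$. For $Y,Y_1,Y_2\subseteq St$: $solve_\neg(Y,v_M)=St\setminus Y$; $solve_\wedge(Y_1,Y_2,v_M)=Y_1\cap Y_2$; $solve_{\langle\langle\Gamma\rangle\rangle\mathrm{X}}(Y,v_M)$ = states $g$ with some $\sigma_\Gamma$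 such that $out_M(g,\sigma_\Gamma)\neq\emptyset$ and $\pi[1]\in Y$ for all its paths; $solve_{\langle\langle\Gamma\rangle\rangle\mathrm{G}}(Y,v_M)$ = same with $\pi[k]\in Y$ for all $k$; $solve_{\langle\langle\Gamma\rangle\rangle\mathrm{U}}(Y_1,Y_2,v_M)$ = same with some $k$ such that $\pi[k]\in Y_2$ and $\pi[j]\in Y_1$ for $j<k$. A partial model $M_{par}$ is given by partial protocols $CP_i:L_i\times Act_i\to\{0,1,undef\}$ and a partial valuation $CV:St\times\mathcal{PV}\to\{0,1,undef\}$. Necessary/possible protocols: $a\in\underline{P_i}(l)$ iff $CP_i(l,a)=1$; $a\in\overline{P_i}(l)$ iff $CP_i(l,a)\neq0$; valuations: $p\in\underline{V}(g)$ iff $CV(g,p)=1$; $p\in\overline{V}(g)$ iff $CV(g,p)\neq0$. $M^{\mathcal{A}}_{under}$ has protocols $\underline{P_i}$ for all $i$ and valuation $\underline{V}$; $M^{\Gamma}_{over}$ has protocols $\overline{P_i}$ for $i\in\Gamma$, $\underline{P_j}$ for $j\notin\Gamma$, and valuation $\overline{V}$. A model is compatible with $M_{par}$ if its protocols and valuation agree with every defined ($0$ or $1$) value of $CP_i$ and $CV$. $SApp_{M_{par}}(\phi,v_{M_1},v_{M_2})$, for encodings of models $M_1,M_2$ compatible with $M_{par}$, is defined recursively: if $\phi=p\in\mathcal{PV}$, return $\{g: M_1,g\models p\}$; if $\phi=\neg\psi$, let $Y=SApp_{M_{par}}(\psi,v_{M_2},v_{M_1})$ and return $solve_\neg(Y,v_{M_2})$;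 if $\phi=op\,\psi$ with $op\in\{\langle\langle\Gamma\rangle\rangle\mathrm{X},\langle\langle\Gamma\rangle\rangle\mathrm{G}\}$, let $Y=SApp_{M_{par}}(\psi,v_{M_1},v_{M_2})$ and return $solve_{op}(Y,v_{M_1})$ if $v_{M_1}=v_{M^{\mathcal{A}}_{under}}$, else $solve_{op}(Y,v_{M^{\Gamma}_{over}})$; if $\phi=\langle\langle\Gamma\rangle\rangle\psi_1\mathrm{U}\psi_2$, let $Y_k=SApp_{M_{par}}(\psi_k,v_{M_1},v_{M_2})$ and return $solve_{\langle\langle\Gamma\rangle\rangle\mathrm{U}}(Y_1,Y_2,v_{M_1})$ if $v_{M_1}=v_{M^{\mathcal{A}}_{under}}$, else $solve_{\langle\langle\Gamma\rangle\rangle\mathrm{U}}(Y_1,Y_2,v_{M^{\Gamma}_{over}})$; if $\phi=\psi_1\wedge\psi_2$, return $solve_\wedge(Y_1,Y_2,v_{M_1})$ with $Y_k$ as before. A set-valued function is positive (resp. negative) monotonic w.r.t. a set $W$ of its variables if changing any single variable of $W$ from $0$ to $1$ (resp. $1$ to $0$), others fixed, yields a value $\supseteq$ the original value. *)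

theory Defs
  imports Main "HOL-Library.FuncSet"
begin

text \<open>Agents are \<open>1..n\<close>. The local state \<open>l\<^sub>i\<^sup>j\<close> and the action \<open>a\<^sub>i\<^sup>j\<close> are both represented
  by the index \<open>j \<in> {1..n\<^sub>i}\<close>; global states and joint actions are extensional functions on the
  set of agents.\<close>

type_synonym gstate = "nat \<Rightarrow> nat"
type_synonym jaction = "nat \<Rightarrow> nat"

record 'p frame =
  nagents :: nat
  nlocal :: "nat \<Rightarrow> nat"
  props :: "'p set"

definition agents :: "'p frame \<Rightarrow> nat set" where
  "agents F = {1..nagents F}"

definition Loc :: "'p frame \<Rightarrow> nat \<Rightarrow> nat set" where
  "Loc F i = {1..nlocal F i}"

definition Act :: "'p frame \<Rightarrow> nat \<Rightarrow> nat set" where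
  "Act F i = {1..nlocal F i}"

definition St :: "'p frame \<Rightarrow> gstate set" where
  "St F = (\<Pi>\<^sub>E i\<in>agents F. Loc F i)"

definition JAct :: "'p frame \<Rightarrow> jaction set" where
  "JAct F = (\<Pi>\<^sub>E i\<in>agents F. Act F i)"

record 'p model =
  prot :: "nat \<Rightarrow> nat \<Rightarrow> nat set"
  val :: "gstate \<Rightarrow> 'p set"

definition is_model :: "'p frame \<Rightarrow> 'p model \<Rightarrow> bool" where
  "is_model F M \<longleftrightarrow>
     (\<forall>i\<in>agents F. \<forall>l\<in>Loc F i. prot M i l \<subseteq> Act F i) \<and>
     (\<forall>g\<in>St F. val M g \<subseteq> props F)"

text \<open>\<open>Some a\<close> on the right is the local state with the same index as the action \<open>a\<close>.\<close>

definition ltrans :: "'p model \<Rightarrow> nat \<Rightarrow> nat \<Rightarrow> nat \<Rightarrow> nat option" where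
  "ltrans M i l a = (if a \<in> prot M i l then Some a else None)"

definition gtrans :: "'p frame \<Rightarrow> 'p model \<Rightarrow> gstate \<Rightarrow> jaction \<Rightarrow> gstate \<Rightarrow> bool" where
  "gtrans F M g a g' \<longleftrightarrow>
     g \<in> St F \<and> a \<in> JAct F \<and> g' \<in> St F \<and>
     (\<forall>i\<in>agents F. ltrans M i (g i) (a i) = Some (g' i))"

text \<open>A path \<open>g\<^sub>0 a\<^sub>0 g\<^sub>1 \<dots>\<close> is infinite; it is the pair of its state and action sequences.\<close>

type_synonym gpath = "(nat \<Rightarrow> gstate) \<times> (nat \<Rightarrow> jaction)"

definition paths :: "'p frame \<Rightarrow> 'p model \<Rightarrow> gstate \<Rightarrow> gpath set" where
  "paths F M g = {(\<pi>, \<alpha>). \<pi> 0 = g \<and> (\<forall>k. gtrans F M (\<pi> k) (\<alpha> k) (\<pi> (Suc k)))}"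

definition is_strategy :: "'p frame \<Rightarrow> 'p model \<Rightarrow> nat \<Rightarrow> (gstate \<Rightarrow> nat) \<Rightarrow> bool" where
  "is_strategy F M i s \<longleftrightarrow> (\<forall>g\<in>St F. s g \<in> Act F i \<and> s g \<in> prot M i (g i))"

definition joint_strategy ::
    "'p frame \<Rightarrow> 'p model \<Rightarrow> nat set \<Rightarrow> (nat \<Rightarrow> gstate \<Rightarrow> nat) \<Rightarrow> bool" where
  "joint_strategy F M \<Gamma> \<sigma> \<longleftrightarrow> (\<forall>i\<in>\<Gamma>. is_strategy F M i (\<sigma> i))"

definition outcome ::
    "'p frame \<Rightarrow> 'p model \<Rightarrow> gstate \<Rightarrow> nat set \<Rightarrow> (nat \<Rightarrow> gstate \<Rightarrow> nat) \<Rightarrow> gpath set" where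
  "outcome F M g \<Gamma> \<sigma> = {(\<pi>, \<alpha>) \<in> paths F M g. \<forall>k. \<forall>j\<in>\<Gamma>. \<alpha> k j = \<sigma> j (\<pi> k)}"

text \<open>A bit vector is indexed by named variables instead of positions in the flattened tables:
  \<open>TB i l a\<close> is the entry \<open>(l, a)\<close> of \<open>tb\<^sub>i\<close> and \<open>VB g p\<close> the entry \<open>(g, p)\<close> of \<open>vb\<close>.
  Encodings are \<^const>\<open>False\<close> at indices that are not variables of the frame, so that equality of
  functions is equality of vectors.\<close>

datatype 'p var = TB nat nat nat | VB gstate 'p

type_synonym 'p bvec = "'p var \<Rightarrow> bool"

definition TBvars :: "'p frame \<Rightarrow> nat \<Rightarrow> 'p var set" where
  "TBvars F i = {TB i l a | l a. l \<in> Loc F i \<and> a \<in> Act F i}"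

definition VBvars :: "'p frame \<Rightarrow> 'p var set" where
  "VBvars F = {VB g p | g p. g \<in> St F \<and> p \<in> props F}"

definition encode :: "'p frame \<Rightarrow> 'p model \<Rightarrow> 'p bvec" where
  "encode F M x =
     (case x of
        TB i l a \<Rightarrow> i \<in> agents F \<and> l \<in> Loc F i \<and> a \<in> Act F i \<and> a \<in> prot M i l
      | VB g p \<Rightarrow> g \<in> St F \<and> p \<in> props F \<and> p \<in> val M g)"

definition decode :: "'p bvec \<Rightarrow> 'p model" where
  "decode v = \<lparr>prot = (\<lambda>i l. {a. v (TB i l a)}), val = (\<lambda>g. {p. v (VB g p)})\<rparr>"

lemma decode_encode:
  assumes "is_model F M"
  shows "\<lbrakk>i \<in> agents F; l \<in> Loc F i\<rbrakk> \<Longrightarrow> prot (decode (encode F M)) i l = prot M i l"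
    and "g \<in> St F \<Longrightarrow> val (decode (encode F M)) g = val M g"
  using assms by (auto simp: decode_def encode_def is_model_def)

definition solve_neg :: "'p frame \<Rightarrow> gstate set \<Rightarrow> 'p bvec \<Rightarrow> gstate set" where
  "solve_neg F Y v = St F - Y"

definition solve_and :: "'p frame \<Rightarrow> gstate set \<Rightarrow> gstate set \<Rightarrow> 'p bvec \<Rightarrow> gstate set" where
  "solve_and F Y1 Y2 v = Y1 \<inter> Y2"

definition solve_X :: "'p frame \<Rightarrow> nat set \<Rightarrow> gstate set \<Rightarrow> 'p bvec \<Rightarrow> gstate set" where
  "solve_X F \<Gamma> Y v =
     {g \<in> St F. \<exists>\<sigma>. joint_strategy F (decode v) \<Gamma> \<sigma> \<and>
        outcome F (decode v) g \<Gamma> \<sigma> \<noteq> {} \<and>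
        (\<forall>(\<pi>, \<alpha>) \<in> outcome F (decode v) g \<Gamma> \<sigma>. \<pi> 1 \<in> Y)}"

definition solve_G :: "'p frame \<Rightarrow> nat set \<Rightarrow> gstate set \<Rightarrow> 'p bvec \<Rightarrow> gstate set" where
  "solve_G F \<Gamma> Y v =
     {g \<in> St F. \<exists>\<sigma>. joint_strategy F (decode v) \<Gamma> \<sigma> \<and>
        outcome F (decode v) g \<Gamma> \<sigma> \<noteq> {} \<and>
        (\<forall>(\<pi>, \<alpha>) \<in> outcome F (decode v) g \<Gamma> \<sigma>. \<forall>k. \<pi> k \<in> Y)}"

definition solve_U ::
    "'p frame \<Rightarrow> nat set \<Rightarrow> gstate set \<Rightarrow> gstate set \<Rightarrow> 'p bvec \<Rightarrow> gstate set" where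
  "solve_U F \<Gamma> Y1 Y2 v =
     {g \<in> St F. \<exists>\<sigma>. joint_strategy F (decode v) \<Gamma> \<sigma> \<and>
        outcome F (decode v) g \<Gamma> \<sigma> \<noteq> {} \<and>
        (\<forall>(\<pi>, \<alpha>) \<in> outcome F (decode v) g \<Gamma> \<sigma>. \<exists>k. \<pi> k \<in> Y2 \<and> (\<forall>j<k. \<pi> j \<in> Y1))}"

text \<open>\<^const>\<open>None\<close> stands for \<open>undef\<close>.\<close>

record 'p pmodel =
  CP :: "nat \<Rightarrow> nat \<Rightarrow> nat \<Rightarrow> bool option"
  CV :: "gstate \<Rightarrow> 'p \<Rightarrow> bool option"

definition nec_prot :: "'p frame \<Rightarrow> 'p pmodel \<Rightarrow> nat \<Rightarrow> nat \<Rightarrow> nat set" where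
  "nec_prot F Mp i l = {a \<in> Act F i. CP Mp i l a = Some True}"

definition pos_prot :: "'p frame \<Rightarrow> 'p pmodel \<Rightarrow> nat \<Rightarrow> nat \<Rightarrow> nat set" where
  "pos_prot F Mp i l = {a \<in> Act F i. CP Mp i l a \<noteq> Some False}"

definition nec_val :: "'p frame \<Rightarrow> 'p pmodel \<Rightarrow> gstate \<Rightarrow> 'p set" where
  "nec_val F Mp g = {p \<in> props F. CV Mp g p = Some True}"

definition pos_val :: "'p frame \<Rightarrow> 'p pmodel \<Rightarrow> gstate \<Rightarrow> 'p set" where
  "pos_val F Mp g = {p \<in> props F. CV Mp g p \<noteq> Some False}"

definition M_under :: "'p frame \<Rightarrow> 'p pmodel \<Rightarrow> 'p model" where
  "M_under F Mp = \<lparr>prot = nec_prot F Mp, val = nec_val F Mp\<rparr>"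

definition M_over :: "'p frame \<Rightarrow> 'p pmodel \<Rightarrow> nat set \<Rightarrow> 'p model" where
  "M_over F Mp \<Gamma> =
     \<lparr>prot = (\<lambda>i. if i \<in> \<Gamma> then pos_prot F Mp i else nec_prot F Mp i), val = pos_val F Mp\<rparr>"

definition compatible :: "'p frame \<Rightarrow> 'p pmodel \<Rightarrow> 'p model \<Rightarrow> bool" where
  "compatible F Mp M \<longleftrightarrow>
     (\<forall>i\<in>agents F. \<forall>l\<in>Loc F i. \<forall>a\<in>Act F i. \<forall>b. CP Mp i l a = Some b \<longrightarrow> (a \<in> prot M i l \<longleftrightarrow> b)) \<and>
     (\<forall>g\<in>St F. \<forall>p\<in>props F. \<forall>b. CV Mp g p = Some b \<longrightarrow> (p \<in> val M g \<longleftrightarrow> b))"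

definition encodings :: "'p frame \<Rightarrow> 'p pmodel \<Rightarrow> 'p bvec set" where
  "encodings F Mp = {encode F M | M. is_model F M \<and> compatible F Mp M}"

lemma M_under_encoding: "encode F (M_under F Mp) \<in> encodings F Mp"
  unfolding encodings_def
  by (rule CollectI, rule exI[of _ "M_under F Mp"])
     (auto simp: M_under_def is_model_def compatible_def nec_prot_def nec_val_def)

lemma M_over_encoding: "encode F (M_over F Mp \<Gamma>) \<in> encodings F Mp"
  unfolding encodings_def
  by (rule CollectI, rule exI[of _ "M_over F Mp \<Gamma>"])
     (auto simp: M_over_def is_model_def compatible_def nec_prot_def pos_prot_def pos_val_def)

datatype 'p form =
    Prop 'p
  | Neg "'p form"
  | And "'p form" "'p form"
  | CanX "nat set" "'p form"
  | CanG "nat set" "'p form"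
  | CanU "nat set" "'p form" "'p form"

primrec SApp :: "'p frame \<Rightarrow> 'p pmodel \<Rightarrow> 'p form \<Rightarrow> 'p bvec \<Rightarrow> 'p bvec \<Rightarrow> gstate set" where
  "SApp F Mp (Prop p) v1 v2 = {g \<in> St F. p \<in> val (decode v1) g}"
| "SApp F Mp (Neg \<psi>) v1 v2 = solve_neg F (SApp F Mp \<psi> v2 v1) v2"
| "SApp F Mp (And \<psi>1 \<psi>2) v1 v2 = solve_and F (SApp F Mp \<psi>1 v1 v2) (SApp F Mp \<psi>2 v1 v2) v1"
| "SApp F Mp (CanX \<Gamma> \<psi>) v1 v2 =
     solve_X F \<Gamma> (SApp F Mp \<psi> v1 v2)
       (if v1 = encode F (M_under F Mp) then v1 else encode F (M_over F Mp \<Gamma>))"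
| "SApp F Mp (CanG \<Gamma> \<psi>) v1 v2 =
     solve_G F \<Gamma> (SApp F Mp \<psi> v1 v2)
       (if v1 = encode F (M_under F Mp) then v1 else encode F (M_over F Mp \<Gamma>))"
| "SApp F Mp (CanU \<Gamma> \<psi>1 \<psi>2) v1 v2 =
     solve_U F \<Gamma> (SApp F Mp \<psi>1 v1 v2) (SApp F Mp \<psi>2 v1 v2)
       (if v1 = encode F (M_under F Mp) then v1 else encode F (M_over F Mp \<Gamma>))"

text \<open>Monotonicity of a set-valued function \<open>f\<close> of Boolean variables, restricted to the domain
  \<open>D\<close>: both the original and the changed assignment have to lie in \<open>D\<close>.\<close>

definition pos_monotonic :: "('x \<Rightarrow> bool) set \<Rightarrow> (('x \<Rightarrow> bool) \<Rightarrow> 'a set) \<Rightarrow> 'x set \<Rightarrow> bool" where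
  "pos_monotonic D f W \<longleftrightarrow>
     (\<forall>x\<in>W. \<forall>w\<in>D. \<not> w x \<longrightarrow> w(x := True) \<in> D \<longrightarrow> f w \<subseteq> f (w(x := True)))"

definition neg_monotonic :: "('x \<Rightarrow> bool) set \<Rightarrow> (('x \<Rightarrow> bool) \<Rightarrow> 'a set) \<Rightarrow> 'x set \<Rightarrow> bool" where
  "neg_monotonic D f W \<longleftrightarrow>
     (\<forall>x\<in>W. \<forall>w\<in>D. w x \<longrightarrow> w(x := False) \<in> D \<longrightarrow> f w \<subseteq> f (w(x := False)))"

text \<open>The two vectors of variables are combined into one, indexed by the disjoint sum: \<^const>\<open>Inl\<close>
  marks the variables of the first vector and \<^const>\<open>Inr\<close> those of the second.\<close>

definition SApp_dom :: "'p frame \<Rightarrow> 'p pmodel \<Rightarrow> ('p var + 'p var \<Rightarrow> bool) set" where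
  "SApp_dom F Mp = {case_sum v1 v2 | v1 v2. v1 \<in> encodings F Mp \<and> v2 \<in> encodings F Mp}"

definition SApp_fun ::
    "'p frame \<Rightarrow> 'p pmodel \<Rightarrow> 'p form \<Rightarrow> ('p var + 'p var \<Rightarrow> bool) \<Rightarrow> gstate set" where
  "SApp_fun F Mp \<phi> w = SApp F Mp \<phi> (w \<circ> Inl) (w \<circ> Inr)"

end

theory Submission imports Defs begin

text \<open>The vector of \<^const>\<open>M_under\<close> is the least compatible encoding. Hence increasing the first argument
  either keeps the model in which a strategic modality is evaluated, or replaces \<^const>\<open>M_under\<close> by
  \<^const>\<open>M_over\<close>. In the latter case only the members of the coalition gain actions, so every strategy
  that was available before is still available and has the same outcome. Monotonicity thus holds
  for all formulas, by induction with the two vectors exchanged at negations.\<close>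

text \<open>A bit of the \<open>M_under\<close> vector is set only where \<open>CP\<close> or
  \<open>CV\<close> has the defined value 1, and compatibility forces that value in every model
  encoded by \<open>v\<close>.\<close>

lemma encode_M_under_le:
  assumes "v \<in> encodings F Mp"
  shows "encode F (M_under F Mp) \<le> v"
proof (rule le_funI)
  fix x
  obtain M where "v = encode F M" "compatible F Mp M"
    using assms by (auto simp: encodings_def)
  then show "encode F (M_under F Mp) x \<le> v x"
    by (cases x) (auto simp: encode_def M_under_def nec_prot_def nec_val_def compatible_def)
qed

lemma decode_encode_prot_iff:
  "a \<in> prot (decode (encode F M)) i l \<longleftrightarrow>
     i \<in> agents F \<and> l \<in> Loc F i \<and> a \<in> Act F i \<and> a \<in> prot M i l"
  by (simp add: decode_def encode_def)

lemma joint_strategy_under_imp_over: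
  assumes "joint_strategy F (decode (encode F (M_under F Mp))) \<Gamma> \<sigma>"
  shows "joint_strategy F (decode (encode F (M_over F Mp \<Gamma>))) \<Gamma> \<sigma>"
  using assms
  by (auto simp: joint_strategy_def is_strategy_def decode_encode_prot_iff M_under_def M_over_def
      nec_prot_def pos_prot_def)

text \<open>The actions of agents in \<Gamma> are prescribed by \<sigma>, hence allowed in both
  models; for agents outside \<Gamma> both models use the necessary protocol.\<close>

lemma gtrans_over_iff_under:
  assumes "joint_strategy F (decode (encode F (M_under F Mp))) \<Gamma> \<sigma>"
    and "\<forall>j\<in>\<Gamma>. a j = \<sigma> j g"
  shows "gtrans F (decode (encode F (M_over F Mp \<Gamma>))) g a g' \<longleftrightarrow>
         gtrans F (decode (encode F (M_under F Mp))) g a g'"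
proof (cases "g \<in> St F")
  case True
  have "a i \<in> prot (decode (encode F (M_over F Mp \<Gamma>))) i (g i) \<longleftrightarrow>
        a i \<in> prot (decode (encode F (M_under F Mp))) i (g i)" for i
  proof (cases "i \<in> \<Gamma>")
    case True
    then show ?thesis
      using assms joint_strategy_under_imp_over[OF assms(1)] \<open>g \<in> St F\<close>
      by (simp add: joint_strategy_def is_strategy_def)
  next
    case False
    then show ?thesis
      by (simp add: decode_encode_prot_iff M_over_def M_under_def)
  qed
  then show ?thesis
    by (simp add: gtrans_def ltrans_def)
qed (simp add: gtrans_def)

lemma outcome_over_eq_under:
  assumes "joint_strategy F (decode (encode F (M_under F Mp))) \<Gamma> \<sigma>"
  shows "outcome F (decode (encode F (M_over F Mp \<Gamma>))) g \<Gamma> \<sigma> =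
         outcome F (decode (encode F (M_under F Mp))) g \<Gamma> \<sigma>"
proof -
  have "(\<pi>, \<alpha>) \<in> outcome F (decode (encode F (M_over F Mp \<Gamma>))) g \<Gamma> \<sigma> \<longleftrightarrow>
        (\<pi>, \<alpha>) \<in> outcome F (decode (encode F (M_under F Mp))) g \<Gamma> \<sigma>" for \<pi> \<alpha>
  \<comment> \<open>Transitions of the two models agree only along action sequences that obey
    \<sigma>; any other sequence lies in neither outcome.\<close>
  proof (cases "\<forall>k. \<forall>j\<in>\<Gamma>. \<alpha> k j = \<sigma> j (\<pi> k)")
    case True
    then show ?thesis
      by (simp add: outcome_def paths_def gtrans_over_iff_under[OF assms])
  qed (auto simp: outcome_def)
  then show ?thesis
    by (intro set_eqI) (simp add: split_paired_all)
qed

text \<open>Common form of the three strategic operators: the winning condition \<open>P\<close>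
  depends on the states of a path only, so X, G and U can be treated at once.\<close>

definition enforce ::
    "'p frame \<Rightarrow> nat set \<Rightarrow> ((nat \<Rightarrow> gstate) \<Rightarrow> bool) \<Rightarrow> 'p bvec \<Rightarrow> gstate set" where
  "enforce F \<Gamma> P v =
     {g \<in> St F. \<exists>\<sigma>. joint_strategy F (decode v) \<Gamma> \<sigma> \<and>
        outcome F (decode v) g \<Gamma> \<sigma> \<noteq> {} \<and>
        (\<forall>(\<pi>, \<alpha>) \<in> outcome F (decode v) g \<Gamma> \<sigma>. P \<pi>)}"

lemma solve_eq_enforce:
  "solve_X F \<Gamma> Y = enforce F \<Gamma> (\<lambda>\<pi>. \<pi> 1 \<in> Y)"
  "solve_G F \<Gamma> Y = enforce F \<Gamma> (\<lambda>\<pi>. \<forall>k. \<pi> k \<in> Y)"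
  "solve_U F \<Gamma> Y Z = enforce F \<Gamma> (\<lambda>\<pi>. \<exists>k. \<pi> k \<in> Z \<and> (\<forall>j<k. \<pi> j \<in> Y))"
  by (simp_all add: fun_eq_iff solve_X_def solve_G_def solve_U_def enforce_def)

lemma enforce_mono:
  assumes "\<And>\<pi>. P \<pi> \<Longrightarrow> Q \<pi>"
  shows "enforce F \<Gamma> P v \<subseteq> enforce F \<Gamma> Q v"
proof
  fix g
  assume "g \<in> enforce F \<Gamma> P v"
  then obtain \<sigma> where "g \<in> St F" "joint_strategy F (decode v) \<Gamma> \<sigma>"
    "outcome F (decode v) g \<Gamma> \<sigma> \<noteq> {}" "\<forall>(\<pi>, \<alpha>) \<in> outcome F (decode v) g \<Gamma> \<sigma>. P \<pi>"
    unfolding enforce_def by blast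
  moreover from this(4) have "\<forall>(\<pi>, \<alpha>) \<in> outcome F (decode v) g \<Gamma> \<sigma>. Q \<pi>"
    using assms by blast
  ultimately show "g \<in> enforce F \<Gamma> Q v"
    unfolding enforce_def by blast
qed

text \<open>The same \<sigma> is the witness: its outcome does not change, so nonemptiness and
  \<open>P\<close> on all its paths carry over.\<close>

lemma enforce_under_subset_over:
  "enforce F \<Gamma> P (encode F (M_under F Mp)) \<subseteq> enforce F \<Gamma> P (encode F (M_over F Mp \<Gamma>))"
proof
  fix g
  let ?M = "decode (encode F (M_under F Mp))"
  assume "g \<in> enforce F \<Gamma> P (encode F (M_under F Mp))"
  then obtain \<sigma> where \<sigma>: "g \<in> St F" "joint_strategy F ?M \<Gamma> \<sigma>"
    "outcome F ?M g \<Gamma> \<sigma> \<noteq> {}" "\<forall>(\<pi>, \<alpha>) \<in> outcome F ?M g \<Gamma> \<sigma>. P \<pi>"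
    unfolding enforce_def by blast
  then show "g \<in> enforce F \<Gamma> P (encode F (M_over F Mp \<Gamma>))"
    unfolding enforce_def mem_Collect_eq
    using joint_strategy_under_imp_over[OF \<sigma>(2)] outcome_over_eq_under[OF \<sigma>(2)]
    by (intro conjI exI[of _ \<sigma>]) simp_all
qed

lemma enforce_under_or_over_mono:
  assumes "v \<in> encodings F Mp" "v \<le> v'" "\<And>\<pi>. P \<pi> \<Longrightarrow> Q \<pi>"
  shows "enforce F \<Gamma> P (if v = encode F (M_under F Mp) then v else encode F (M_over F Mp \<Gamma>)) \<subseteq>
         enforce F \<Gamma> Q (if v' = encode F (M_under F Mp) then v' else encode F (M_over F Mp \<Gamma>))"
    (is "enforce _ _ _ ?u \<subseteq> enforce _ _ _ ?u'")
proof -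
  \<comment> \<open>The condition is first weakened from \<open>P\<close> to \<open>Q\<close> within
    \<open>?u\<close>, then the model changes from \<open>?u\<close> to \<open>?u'\<close> with
    \<open>Q\<close> fixed; this is the second inclusion.\<close>
  have "enforce F \<Gamma> Q ?u \<subseteq> enforce F \<Gamma> Q ?u'"
  proof (cases "v' = encode F (M_under F Mp)")
    case True
    \<comment> \<open>By antisymmetry: \<open>v\<close> lies below \<open>v'\<close>, which is the
      least encoding.\<close>
    then have "v = encode F (M_under F Mp)"
      using encode_M_under_le[OF assms(1)] assms(2) by simp
    with True show ?thesis
      by simp
  next
    case False
    \<comment> \<open>Here \<open>?u'\<close> is the \<open>M_over\<close> vector, and
      \<open>?u\<close> is either that same vector or the \<open>M_under\<close> one.\<close>
    then show ?thesis
      by (simp add: enforce_under_subset_over)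
  qed
  then show ?thesis
    using enforce_mono[of P Q, OF assms(3)] by (rule order_trans[rotated])
qed

lemma SApp_mono:
  assumes "v1 \<in> encodings F Mp" "v2 \<in> encodings F Mp"
    and "v1' \<in> encodings F Mp" "v2' \<in> encodings F Mp"
    and "v1 \<le> v1'" "v2' \<le> v2"
  shows "SApp F Mp \<phi> v1 v2 \<subseteq> SApp F Mp \<phi> v1' v2'"
  using assms
proof (induction \<phi> arbitrary: v1 v2 v1' v2')
  case (Prop p)
  then show ?case
    by (auto simp: decode_def le_fun_def)
next
  case (Neg \<psi>)
  \<comment> \<open>Induction hypothesis with the pairs exchanged: \<open>v2' \<le> v2\<close> now
    orders the first arguments. The complement then reverses the inclusion.\<close>
  then have "SApp F Mp \<psi> v2' v1' \<subseteq> SApp F Mp \<psi> v2 v1"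
    by simp
  then show ?case
    by (auto simp: solve_neg_def)
next
  case (And \<psi>1 \<psi>2)
  then have "SApp F Mp \<psi>1 v1 v2 \<subseteq> SApp F Mp \<psi>1 v1' v2'"
    "SApp F Mp \<psi>2 v1 v2 \<subseteq> SApp F Mp \<psi>2 v1' v2'"
    by simp_all
  then show ?case
    by (auto simp: solve_and_def)
next
  case (CanX \<Gamma> \<psi>)
  then have "SApp F Mp \<psi> v1 v2 \<subseteq> SApp F Mp \<psi> v1' v2'"
    by simp
  with CanX.prems(1,5) show ?case
    unfolding SApp.simps solve_eq_enforce by (intro enforce_under_or_over_mono) auto
next
  case (CanG \<Gamma> \<psi>)
  then have "SApp F Mp \<psi> v1 v2 \<subseteq> SApp F Mp \<psi> v1' v2'"
    by simp
  with CanG.prems(1,5) show ?case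
    unfolding SApp.simps solve_eq_enforce by (intro enforce_under_or_over_mono) auto
next
  case (CanU \<Gamma> \<psi>1 \<psi>2)
  then have "SApp F Mp \<psi>1 v1 v2 \<subseteq> SApp F Mp \<psi>1 v1' v2'"
    "SApp F Mp \<psi>2 v1 v2 \<subseteq> SApp F Mp \<psi>2 v1' v2'"
    by simp_all
  with CanU.prems(1,5) show ?case
    unfolding SApp.simps solve_eq_enforce by (intro enforce_under_or_over_mono) blast+
qed

text \<open>Transfers \<open>SApp_mono\<close> to combined assignments, which
  \<open>SApp_dom\<close> guarantees to split into two encodings.\<close>

lemma SApp_fun_mono:
  assumes "w \<in> SApp_dom F Mp" "w' \<in> SApp_dom F Mp"
    and "w \<circ> Inl \<le> w' \<circ> Inl" "w' \<circ> Inr \<le> w \<circ> Inr"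
  shows "SApp_fun F Mp \<phi> w \<subseteq> SApp_fun F Mp \<phi> w'"
proof -
  have "u \<circ> Inl \<in> encodings F Mp \<and> u \<circ> Inr \<in> encodings F Mp" if "u \<in> SApp_dom F Mp" for u
    using that by (auto simp: SApp_dom_def case_sum_o_inj)
  then show ?thesis
    unfolding SApp_fun_def using assms by (intro SApp_mono) simp_all
qed

text \<open>Setting one \<open>Inl\<close> bit raises the first vector and fixes the second. As
  \<open>W\<close> is arbitrary, this covers protocol and valuation variables alike.\<close>

lemma pos_monotonic_SApp_fun: "pos_monotonic (SApp_dom F Mp) (SApp_fun F Mp \<phi>) (Inl ` W)"
  unfolding pos_monotonic_def by (intro ballI impI SApp_fun_mono) (auto simp: le_fun_def)

lemma neg_monotonic_SApp_fun: "neg_monotonic (SApp_dom F Mp) (SApp_fun F Mp \<phi>) (Inr ` W)"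
  unfolding neg_monotonic_def by (intro ballI impI SApp_fun_mono) (auto simp: le_fun_def)

theorem theorem4p2:
  fixes F :: "'p frame" and Mp :: "'p pmodel" and p q :: 'p and \<Gamma> :: "nat set"
  assumes "finite (props F)" and "p \<in> props F" and "q \<in> props F" and "\<Gamma> \<subseteq> agents F"
  shows "(\<forall>\<phi> \<in> {Prop p, Neg (Prop p), And (Prop p) (Prop q)}.
            (\<forall>i\<in>agents F. pos_monotonic (SApp_dom F Mp) (SApp_fun F Mp \<phi>) (Inl ` TBvars F i)) \<and>
            pos_monotonic (SApp_dom F Mp) (SApp_fun F Mp \<phi>) (Inl ` VBvars F) \<and>
            (\<forall>i\<in>agents F. neg_monotonic (SApp_dom F Mp) (SApp_fun F Mp \<phi>) (Inr ` TBvars F i)) \<and>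
            neg_monotonic (SApp_dom F Mp) (SApp_fun F Mp \<phi>) (Inr ` VBvars F)) \<and>
         (\<forall>\<phi> \<in> {CanX \<Gamma> (Prop p), CanG \<Gamma> (Prop p), CanU \<Gamma> (Prop p) (Prop q)}.
            (\<forall>i\<in>\<Gamma>. pos_monotonic (SApp_dom F Mp) (SApp_fun F Mp \<phi>) (Inl ` TBvars F i)) \<and>
            pos_monotonic (SApp_dom F Mp) (SApp_fun F Mp \<phi>) (Inl ` VBvars F) \<and>
            (\<forall>i\<in>\<Gamma>. neg_monotonic (SApp_dom F Mp) (SApp_fun F Mp \<phi>) (Inr ` TBvars F i)) \<and>
            neg_monotonic (SApp_dom F Mp) (SApp_fun F Mp \<phi>) (Inr ` VBvars F))"
  by (simp add: pos_monotonic_SApp_fun neg_monotonic_SApp_fun)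

end
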